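(* Let $n\in\mathbb{N}$, let $B$ be an $n\times n$ matrix over $\mathbb{Z}$, and let $\delta=\gcd B$. Let $\phi$ be an automorphism of $\operatorname{cok}B$, let $\psi$ be an automorphism of $\ker B$, and let $M$ be any $n\times n$ matrix over $\mathbb{Z}$ inducing $\phi$, i.e., $\phi([x])=[Mx]$ for all $x\in\mathbb{Z}^n$. Then $\det(M)\equiv\pm1\pmod{\delta}$ if and only if there exist $n\times n$ matrices $U,V\in\mathrm{GL}_n(\mathbb{Z})$ such that $UBV=B$, $U$ induces $\phi$ on $\operatorname{cok}B$, and $V^{-1}$ induces $\psi$ on $\ker B$.
   Context: $\operatorname{cok}B=\mathbb{Z}^n/B\mathbb{Z}^n$ and $\ker B=\{x\in\mathbb{Z}^n: Bx=0\}$. $\gcd B$ is the greatest common divisor of the entries of $B$ (equal to $0$ if $B=0$; congruence modulo $0$ means equality). A matrix $U$ induces $\phi$ on $\operatorname{cok}B$ if $\phi([x])=[Ux]$; if $UBV=B$ then $V^{-1}$ maps $\ker B$ into itself, and $V^{-1}$ induces $\psi$ if $\psi(x)=V^{-1}x$ for $x\in\ker B$. *)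

theory Defs
  imports "HOL-Analysis.Analysis" "HOL-Algebra.Coset" "HOL-Number_Theory.Cong"
begin

definition Zn :: "(int ^ 'n) monoid" where
  "Zn = \<lparr>carrier = UNIV, monoid.mult = (+), one = 0\<rparr>"

definition colspace :: "int ^ 'n ^ 'n \<Rightarrow> (int ^ 'n) set" where
  "colspace B = range (\<lambda>z. B *v z)"

definition cok :: "int ^ 'n ^ 'n \<Rightarrow> ((int ^ 'n) set) monoid" where
  "cok B = Zn Mod (colspace B)"

definition cok_class :: "int ^ 'n ^ 'n \<Rightarrow> int ^ 'n \<Rightarrow> (int ^ 'n) set" where
  "cok_class B x = colspace B #>\<^bsub>Zn\<^esub> x"

definition kergrp :: "int ^ 'n ^ 'n \<Rightarrow> (int ^ 'n) monoid" where
  "kergrp B = \<lparr>carrier = {x. B *v x = 0}, monoid.mult = (+), one = 0\<rparr>"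

text \<open>gcd of all entries of B (0 if B = 0).\<close>
definition gcd_mat :: "int ^ 'n ^ 'n \<Rightarrow> int" where
  "gcd_mat B = Gcd {B $ i $ j | i j. True}"

definition induces_cok :: "int ^ 'n ^ 'n \<Rightarrow> int ^ 'n ^ 'n \<Rightarrow> ((int ^ 'n) set \<Rightarrow> (int ^ 'n) set) \<Rightarrow> bool" where
  "induces_cok B U \<phi> \<longleftrightarrow> (\<forall>x. \<phi> (cok_class B x) = cok_class B (U *v x))"

definition induces_ker :: "int ^ 'n ^ 'n \<Rightarrow> int ^ 'n ^ 'n \<Rightarrow> (int ^ 'n \<Rightarrow> int ^ 'n) \<Rightarrow> bool" where
  "induces_ker B W \<psi> \<longleftrightarrow> (\<forall>x. B *v x = 0 \<longrightarrow> \<psi> x = W *v x)"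

end

theory Submission
  imports Defs
begin

text \<open>Surjectivity of \<open>\<phi>\<close> says that the columns of \<open>M\<close> and \<open>B\<close> together span \<open>\<int>\<^sup>n\<close>, and any \<open>U\<close>
  inducing \<open>\<phi>\<close> is \<open>M + BY\<close>; this gives the congruence for the determinants. Conversely, choose a
  primitive \<open>w\<close> with \<open>\<delta> w \<in> B \<int>\<^sup>n\<close>. In \<open>\<int>\<^sup>n / \<int> w\<close>, which has rank \<open>n - 1\<close>, the \<open>n\<close> columns of \<open>M\<close> can be
  corrected by columns from \<open>B \<int>\<^sup>n\<close> until they span, because there is one column to spare (a stable
  range argument). Up to column operations only the \<open>w\<close>-coefficient \<open>c\<close> of one column is then left,
  with \<open>c \<equiv> \<plusminus>det M\<close> modulo \<open>\<delta>\<close>, and adding a multiple of \<open>\<delta> w\<close> makes it \<open>\<plusminus>1\<close>. The matrix \<open>V\<close>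
  exists for every such \<open>U\<close> and every \<open>\<psi>\<close>, since \<open>ker B\<close> is a direct summand of \<open>\<int>\<^sup>n\<close>.\<close>

section \<open>Subgroups of integer vectors and column operations\<close>

text \<open>The subgroup generated by \<open>A\<close>. Closure under differences already yields
  negatives, sums and integer multiples, and keeps inductions to three cases.\<close>

inductive_set int_span :: "(int ^ 'n) set \<Rightarrow> (int ^ 'n) set" for A where
  int_span_base: "x \<in> A \<Longrightarrow> x \<in> int_span A"
| int_span_zero: "0 \<in> int_span A"
| int_span_diff: "x \<in> int_span A \<Longrightarrow> y \<in> int_span A \<Longrightarrow> x - y \<in> int_span A"

lemma int_span_uminus: "x \<in> int_span A \<Longrightarrow> - x \<in> int_span A"
  using int_span_diff[OF int_span_zero] by force

lemma int_span_add: "x \<in> int_span A \<Longrightarrow> y \<in> int_span A \<Longrightarrow> x + y \<in> int_span A"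
  using int_span_diff[OF _ int_span_uminus] by force

lemma int_span_scale: "x \<in> int_span A \<Longrightarrow> k *s x \<in> int_span A"
proof (induction k rule: int_induct[where k = 0])
  case base
  then show ?case by (simp add: int_span_zero)
next
  case (step1 i)
  then show ?case by (simp add: vector_sadd_rdistrib int_span_add)
next
  case (step2 i)
  then show ?case by (simp add: vector_sub_rdistrib int_span_diff)
qed

lemma int_span_sum: "(\<And>i. i \<in> I \<Longrightarrow> f i \<in> int_span A) \<Longrightarrow> sum f I \<in> int_span A"
  by (induction I rule: infinite_finite_induct) (auto intro: int_span_zero int_span_add)

lemma int_span_subset: "A \<subseteq> int_span C \<Longrightarrow> int_span A \<subseteq> int_span C"
proof
  fix x assume "A \<subseteq> int_span C" "x \<in> int_span A"
  then show "x \<in> int_span C"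
    by (induction rule: int_span.induct[OF \<open>x \<in> int_span A\<close>]) (auto intro: int_span_zero int_span_diff)
qed

lemma int_span_mono: "A \<subseteq> C \<Longrightarrow> int_span A \<subseteq> int_span C"
  by (meson int_span_base int_span_subset subset_iff)

lemma int_span_closed:
  assumes "x \<in> int_span G" "G \<subseteq> H" "0 \<in> H" "\<And>x y. x \<in> H \<Longrightarrow> y \<in> H \<Longrightarrow> x - y \<in> H"
  shows "x \<in> H"
  using assms(1) by induction (use assms(2-) in auto)

lemma int_span_insert: "x \<in> int_span (insert y A) \<Longrightarrow> \<exists>k. x - k *s y \<in> int_span A"
proof (induction rule: int_span.induct)
  case (int_span_base x)
  show ?case
  proof (cases "x = y")
    case True
    then have "x - 1 *s y \<in> int_span A" by (simp add: int_span_zero)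
    then show ?thesis by blast
  next
    case False
    then have "x - 0 *s y \<in> int_span A" using int_span_base by (simp add: int_span.int_span_base)
    then show ?thesis by blast
  qed
next
  case int_span_zero
  have "0 - 0 *s y \<in> int_span A" by (simp add: int_span.int_span_zero)
  then show ?case by blast
next
  case (int_span_diff x x')
  then obtain k k' where "x - k *s y \<in> int_span A" "x' - k' *s y \<in> int_span A" by blast
  then have "(x - k *s y) - (x' - k' *s y) \<in> int_span A" by (rule int_span.int_span_diff)
  then have "(x - x') - (k - k') *s y \<in> int_span A"
    by (simp add: vector_sub_rdistrib algebra_simps)
  then show ?case by blast
qed

section \<open>Column operations modulo a subgroup\<close>

text \<open>All columns in \<open>T\<close> change at once by combinations of the untouched columns
  in \<open>J - T\<close> and of \<open>G\<close>. Keeping sources and targets disjoint makes the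
  operation reversible. The set \<open>G\<close> supplies admissible corrections; in the main
  application it is a column space.\<close>

definition col_step :: "(int ^ 'n) set \<Rightarrow> 'n set \<Rightarrow> ('n \<Rightarrow> int ^ 'n) \<Rightarrow> ('n \<Rightarrow> int ^ 'n) \<Rightarrow> bool" where
  "col_step G J f f' \<longleftrightarrow> (\<exists>T \<subseteq> J. \<forall>j. if j \<in> T then f' j - f j \<in> int_span (f ` (J - T) \<union> G) else f' j = f j)"

lemma col_stepE:
  assumes "col_step G J f f'"
  obtains T where "T \<subseteq> J" "\<And>j. j \<in> T \<Longrightarrow> f' j - f j \<in> int_span (f ` (J - T) \<union> G)"
    "\<And>j. j \<notin> T \<Longrightarrow> f' j = f j"
proof -
  obtain T where "T \<subseteq> J"
    and T: "\<forall>j. if j \<in> T then f' j - f j \<in> int_span (f ` (J - T) \<union> G) else f' j = f j"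
    using assms unfolding col_step_def by blast
  moreover have "f' j - f j \<in> int_span (f ` (J - T) \<union> G)" if "j \<in> T" for j
    using T[rule_format, of j] that by simp
  moreover have "f' j = f j" if "j \<notin> T" for j using T[rule_format, of j] that by simp
  ultimately show thesis using that by blast
qed

lemma col_step_upd:
  assumes "i \<in> J" "x \<in> int_span (f ` (J - {i}) \<union> G)"
  shows "col_step G J f (f(i := f i + x))"
  unfolding col_step_def using assms by (intro exI[of _ "{i}"]) auto

lemma col_step_upd_scaled:
  assumes "i \<in> J" "j \<in> J" "i \<noteq> j"
  shows "col_step G J f (f(i := f i + k *s f j))"
  using assms by (intro col_step_upd int_span_scale int_span_base) auto

text \<open>The source columns survive unchanged, so subtracting the added combination recovers each
  old column. This inclusion carries a spanning hypothesis along a sequence of steps.\<close>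

lemma col_step_int_span:
  assumes "col_step G J f f'"
  shows "int_span (f ` J \<union> G) \<subseteq> int_span (f' ` J \<union> G)"
proof (rule int_span_subset)
  obtain T where T: "T \<subseteq> J"
    "\<And>j. j \<in> T \<Longrightarrow> f' j - f j \<in> int_span (f ` (J - T) \<union> G)" "\<And>j. j \<notin> T \<Longrightarrow> f' j = f j"
    by (rule col_stepE[OF assms]) (rule that; assumption)
  have "f ` (J - T) = f' ` (J - T)" using T(3) by (auto simp: image_iff)
  then have sub: "int_span (f ` (J - T) \<union> G) \<subseteq> int_span (f' ` J \<union> G)"
    by (intro int_span_mono) auto
  have "f j \<in> int_span (f' ` J \<union> G)" if "j \<in> J" for j
  proof (cases "j \<in> T")
    case True
    have "f' j \<in> int_span (f' ` J \<union> G)" using that by (simp add: int_span_base)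
    then have "f' j - (f' j - f j) \<in> int_span (f' ` J \<union> G)"
      using T(2)[OF True] sub by (blast intro: int_span_diff)
    then show ?thesis by simp
  next
    case False
    then show ?thesis using T(3)[OF False] that by (metis UnI1 image_eqI int_span_base)
  qed
  then show "f ` J \<union> G \<subseteq> int_span (f' ` J \<union> G)" by (auto intro: int_span_base)
qed

lemma col_steps_int_span:
  assumes "(col_step G J)\<^sup>*\<^sup>* f f'"
  shows "int_span (f ` J \<union> G) \<subseteq> int_span (f' ` J \<union> G)"
  using assms by induction (use col_step_int_span in blast)+

text \<open>Euclid's algorithm on row \<open>c\<close> of the two columns; each round that does not
  finish lowers the absolute value of the entry in column \<open>i\<close>.\<close>

lemma col_steps_euclid:
  fixes f :: "'n::finite \<Rightarrow> int ^ 'n"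
  assumes "i \<in> J" "j \<in> J" "i \<noteq> j"
  shows "\<exists>f'. (col_step G J)\<^sup>*\<^sup>* f f' \<and> f' i $ c = 0"
proof (induction "nat \<bar>f i $ c\<bar>" arbitrary: f rule: less_induct)
  case less
  show ?case
  proof (cases "f i $ c = 0")
    case True
    then show ?thesis by blast
  next
    case False
    define g where "g = f(j := f j + (- (f j $ c div f i $ c)) *s f i)"
    have fg: "col_step G J f g" unfolding g_def using assms by (intro col_step_upd_scaled) auto
    have gi: "g i = f i" and gj: "g j $ c = f j $ c mod f i $ c"
      using assms minus_div_mult_eq_mod[of "f j $ c" "f i $ c"] by (simp_all add: g_def)
    have small: "\<bar>g j $ c\<bar> < \<bar>f i $ c\<bar>" using False by (simp add: gj abs_mod_less)
    show ?thesis
    proof (cases "g j $ c = 0")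
      case True
      \<comment> \<open>The nonzero entry has to leave column \<open>i\<close>: adding column
        \<open>i\<close> to column \<open>j\<close> copies it there, and subtracting column
        \<open>j\<close> from column \<open>i\<close> then cancels it.\<close>
      define h where "h = g(j := g j + 1 *s g i)"
      define h' where "h' = h(i := h i + (-1) *s h j)"
      have "col_step G J g h" "col_step G J h h'"
        unfolding h_def h'_def using assms by (blast intro: col_step_upd_scaled)+
      moreover have "h' i $ c = 0" using True assms by (simp add: h'_def h_def)
      ultimately show ?thesis using fg by (meson converse_rtranclp_into_rtranclp rtranclp.rtrancl_refl)
    next
      case nz: False
      define h where "h = g(i := g i + (- (g i $ c div g j $ c)) *s g j)"
      have gh: "col_step G J g h" unfolding h_def using assms by (intro col_step_upd_scaled) auto
      have "h i $ c = g i $ c mod g j $ c"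
        using assms minus_div_mult_eq_mod[of "g i $ c" "g j $ c"] by (simp add: h_def)
      then have "\<bar>h i $ c\<bar> < \<bar>g j $ c\<bar>" using nz by (simp add: abs_mod_less)
      then have "nat \<bar>h i $ c\<bar> < nat \<bar>f i $ c\<bar>" using small by simp
      then obtain f' where "(col_step G J)\<^sup>*\<^sup>* h f'" "f' i $ c = 0" using less by blast
      then show ?thesis using fg gh by (meson converse_rtranclp_into_rtranclp)
    qed
  qed
qed

text \<open>The projected generators differ from those in \<open>G\<close> by multiples of
  \<open>b\<close>, and \<open>b\<close> is the unchanged column \<open>i\<close>, so a step with
  them is a step with \<open>G\<close>. All its sources vanish in coordinate \<open>i\<close>, hence
  so do the new columns other than \<open>i\<close>.\<close>

lemma col_step_project:
  fixes f :: "'n::finite \<Rightarrow> int ^ 'n"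
  assumes step: "col_step ((\<lambda>u. u - u $ i *s b) ` G) (J - {i}) f f'"
    and "i \<in> J" "f i = b" "b $ i = 1" "\<And>j. j \<in> J - {i} \<Longrightarrow> f j $ i = 0"
  shows "col_step G J f f' \<and> f' i = b \<and> (\<forall>j \<in> J - {i}. f' j $ i = 0)"
proof -
  let ?G = "(\<lambda>u. u - u $ i *s b) ` G"
  obtain T where T: "T \<subseteq> J - {i}"
    "\<And>j. j \<in> T \<Longrightarrow> f' j - f j \<in> int_span (f ` (J - {i} - T) \<union> ?G)" "\<And>j. j \<notin> T \<Longrightarrow> f' j = f j"
    by (rule col_stepE[OF step]) (rule that; assumption)
  have b: "b \<in> f ` (J - T)" using assms T(1) by auto
  have "u - u $ i *s b \<in> int_span (f ` (J - T) \<union> G)" if "u \<in> G" for u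
    using b that by (blast intro: int_span_diff int_span_scale int_span_base)
  moreover have "f ` (J - {i} - T) \<subseteq> int_span (f ` (J - T) \<union> G)"
    by (blast intro: int_span_base)
  ultimately have "f ` (J - {i} - T) \<union> ?G \<subseteq> int_span (f ` (J - T) \<union> G)" by blast
  then have sub: "int_span (f ` (J - {i} - T) \<union> ?G) \<subseteq> int_span (f ` (J - T) \<union> G)"
    by (rule int_span_subset)
  have "f' j $ i = 0" if "j \<in> J - {i}" for j
  proof (cases "j \<in> T")
    case True
    from T(2)[OF True] have "f' j - f j \<in> {x. x $ i = 0}"
      by (rule int_span_closed) (use assms in auto)
    then show ?thesis using assms(5)[OF that] by simp
  next
    case False
    then show ?thesis using T(3) assms(5)[OF that] by simp
  qed
  moreover have "col_step G J f f'"
    unfolding col_step_def using T sub by (intro exI[of _ T]) auto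
  moreover have "f' i = b" using T assms by auto
  ultimately show ?thesis by blast
qed

lemma col_steps_project:
  fixes f :: "'n::finite \<Rightarrow> int ^ 'n"
  assumes "(col_step ((\<lambda>u. u - u $ i *s b) ` G) (J - {i}))\<^sup>*\<^sup>* f f'"
    and "i \<in> J" "f i = b" "b $ i = 1" "\<And>j. j \<in> J - {i} \<Longrightarrow> f j $ i = 0"
  shows "(col_step G J)\<^sup>*\<^sup>* f f' \<and> f' i = b \<and> (\<forall>j \<in> J - {i}. f' j $ i = 0)"
  using assms(1)
proof induction
  case base
  then show ?case using assms by auto
next
  case (step g h)
  then show ?case using col_step_project[OF step(2) assms(2) _ assms(4)] by (auto intro: rtranclp.rtrancl_into_rtrancl)
qed

text \<open>The surplus column of \<open>J - S\<close> makes room for Euclid's algorithm: column \<open>i\<close> is freed in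
  coordinate \<open>i\<close> before it receives a combination with value 1 there.\<close>

lemma reduce_columns:
  fixes f :: "'n::finite \<Rightarrow> int ^ 'n"
  assumes "S \<subset> J" "\<And>v. \<exists>x \<in> int_span (f ` J \<union> G). \<forall>i \<in> S. x $ i = v $ i"
  shows "\<exists>f'. (col_step G J)\<^sup>*\<^sup>* f f' \<and> (\<forall>i \<in> S. \<forall>j \<in> J. f' j $ i = (if j = i then 1 else 0))"
  using finite[of S] assms
proof (induction S arbitrary: f G J rule: finite_induct)
  case empty
  then show ?case by auto
next
  case (insert i S)
  obtain j1 where j1: "j1 \<in> J" "j1 \<noteq> i" using insert.prems(1) by blast
  have iJ: "i \<in> J" using insert.prems(1) by blast
  obtain f1 where f1: "(col_step G J)\<^sup>*\<^sup>* f f1" "f1 i $ i = 0"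
    using col_steps_euclid[OF iJ j1(1) j1(2)[symmetric]] by blast
  obtain x where x: "x \<in> int_span (f1 ` J \<union> G)" "x $ i = 1"
    using insert.prems(2)[of 1] col_steps_int_span[OF f1(1)] by (auto simp: one_vec_def)
  have "f1 ` J \<union> G = insert (f1 i) (f1 ` (J - {i}) \<union> G)" using iJ by auto
  then obtain k where k: "x - k *s f1 i \<in> int_span (f1 ` (J - {i}) \<union> G)"
    using int_span_insert x(1) by metis
  \<comment> \<open>Column \<open>i\<close> vanishes in coordinate \<open>i\<close>. Dropping its
    own share \<open>k *s f1 i\<close> from \<open>x\<close> therefore keeps that coordinate at 1,
    while the operation draws only on the other columns and \<open>G\<close>.\<close>
  define f2 where "f2 = f1(i := f1 i + (x - k *s f1 i))"
  have f2: "col_step G J f1 f2" unfolding f2_def by (rule col_step_upd[OF iJ k])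
  have f2i: "f2 i $ i = 1" using f1(2) x(2) by (simp add: f2_def)
  define f3 where "f3 = (\<lambda>j. if j \<in> J - {i} then f2 j - f2 j $ i *s f2 i else f2 j)"
  have "- (f2 j $ i *s f2 i) \<in> int_span (f2 ` (J - (J - {i})) \<union> G)" for j
    using iJ by (intro int_span_uminus int_span_scale int_span_base) auto
  then have f3: "col_step G J f2 f3"
    unfolding col_step_def f3_def by (intro exI[of _ "J - {i}"]) auto
  define b where "b = f3 i"
  have b: "b $ i = 1" using f2i by (simp add: b_def f3_def)
  have f3z: "f3 j $ i = 0" if "j \<in> J - {i}" for j using that f2i by (simp add: f3_def)
  have ff3: "(col_step G J)\<^sup>*\<^sup>* f f3" using f1(1) f2 f3 by (meson rtranclp.rtrancl_into_rtrancl)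
  let ?r = "\<lambda>u. u - u $ i *s b"
  \<comment> \<open>Projecting along \<open>b\<close> sends column \<open>i\<close> to 0 and fixes
    the other columns of \<open>J\<close>, so column \<open>i\<close> can be removed for the
    induction once \<open>G\<close> is projected too.\<close>
  have r: "?r x \<in> int_span (f3 ` (J - {i}) \<union> ?r ` G)" if "x \<in> int_span (f3 ` J \<union> G)" for x
    using that
  proof induction
    case (int_span_base x)
    consider "x = f3 i" | j where "j \<in> J - {i}" "x = f3 j" | "x \<in> G" using int_span_base by blast
    then show ?case
    proof cases
      case 1
      then show ?thesis using b b_def by (simp add: int_span_zero)
    next
      case 2
      then show ?thesis using f3z by (simp add: int_span.int_span_base)
    next
      case 3
      then show ?thesis by (simp add: int_span.int_span_base)
    qed
  next
    case int_span_zero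
    show ?case by (simp add: int_span.int_span_zero)
  next
    case (int_span_diff x y)
    have "?r (x - y) = ?r x - ?r y" by (simp add: vector_sub_rdistrib algebra_simps)
    then show ?case using int_span.int_span_diff[OF int_span_diff.IH] by metis
  qed
  have "\<exists>x \<in> int_span (f3 ` (J - {i}) \<union> ?r ` G). \<forall>k \<in> S. x $ k = v $ k" for v
  proof -
    \<comment> \<open>Subtracting the \<open>i\<close>-th coordinate from \<open>v\<close> forces
      \<open>x $ i = 0\<close>, so the projection fixes \<open>x\<close>; the coordinates in
      \<open>S\<close> do not include \<open>i\<close> and are unaffected.\<close>
    obtain x where x: "x \<in> int_span (f3 ` J \<union> G)"
      "\<forall>k \<in> insert i S. x $ k = (v - v $ i *s axis i 1) $ k"
      using insert.prems(2)[of "v - v $ i *s axis i 1"] col_steps_int_span[OF ff3] by blast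
    have "x $ i = 0" using x(2) by (simp add: axis_def)
    then have "x \<in> int_span (f3 ` (J - {i}) \<union> ?r ` G)" using r[OF x(1)] by simp
    moreover have "\<forall>k \<in> S. x $ k = v $ k" using x(2) insert.hyps by (auto simp: axis_def)
    ultimately show ?thesis by blast
  qed
  moreover have "S \<subset> J - {i}" using insert by blast
  ultimately obtain f4 where f4: "(col_step (?r ` G) (J - {i}))\<^sup>*\<^sup>* f3 f4"
    "\<forall>k \<in> S. \<forall>j \<in> J - {i}. f4 j $ k = (if j = k then 1 else 0)"
    using insert.IH[of "J - {i}" f3 "?r ` G"] by blast
  have f4': "(col_step G J)\<^sup>*\<^sup>* f3 f4" "f4 i = b" "\<forall>j \<in> J - {i}. f4 j $ i = 0"
    using col_steps_project[OF f4(1) iJ b_def[symmetric] b f3z] by auto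
  \<comment> \<open>Only column \<open>i\<close> may still have nonzero entries in the rows of
    \<open>S\<close>. The columns indexed by \<open>S\<close> are unit vectors there and clear them;
    as these columns vanish in row \<open>i\<close>, the 1 in that row stays.\<close>
  define f5 where "f5 = f4(i := f4 i + - (\<Sum>k\<in>S. f4 i $ k *s f4 k))"
  have "- (\<Sum>k\<in>S. f4 i $ k *s f4 k) \<in> int_span (f4 ` (J - {i}) \<union> G)"
    using \<open>S \<subset> J - {i}\<close>
    by (intro int_span_uminus int_span_sum int_span_scale int_span_base) auto
  then have f5: "col_step G J f4 f5" unfolding f5_def by (rule col_step_upd[OF iJ])
  have "f5 j $ k = (if j = k then 1 else 0)" if k: "k \<in> insert i S" and j: "j \<in> J" for k j
  proof (cases "j = i")
    case False
    then show ?thesis using k j f4(2) f4'(3) by (auto simp: f5_def)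
  next
    case True
    have SJ: "S \<subseteq> J - {i}" using \<open>S \<subset> J - {i}\<close> by blast
    show ?thesis
    proof (cases "k = i")
      case True
      have "(\<Sum>l\<in>S. f4 i $ l * f4 l $ i) = 0" using SJ f4'(3) by (intro sum.neutral) auto
      then show ?thesis using True \<open>j = i\<close> f4'(2) b by (simp add: f5_def)
    next
      case False
      then have "k \<in> S" using k by blast
      have "f4 l $ k = (if l = k then 1 else 0)" if "l \<in> S" for l
        using that SJ f4(2) \<open>k \<in> S\<close> by blast
      then have "(\<Sum>l\<in>S. f4 i $ l * f4 l $ k) = (\<Sum>l\<in>S. if l = k then f4 i $ l else 0)"
        by (intro sum.cong) auto
      also have "\<dots> = f4 i $ k" using \<open>k \<in> S\<close> by simp
      finally show ?thesis using False \<open>j = i\<close> by (simp add: f5_def)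
    qed
  qed
  moreover have "(col_step G J)\<^sup>*\<^sup>* f f5" using ff3 f4'(1) f5 by (meson rtranclp.rtrancl_into_rtrancl rtranclp_trans)
  ultimately show ?case by blast
qed

section \<open>Column operations as matrix products\<close>

definition col_matrix :: "('n \<Rightarrow> int ^ 'n) \<Rightarrow> int ^ 'n ^ 'n" where
  "col_matrix f = (\<chi> i j. f j $ i)"

lemma matrix_vector_axis: "A *v axis j 1 = column j (A :: int ^ 'n ^ 'm)"
  by (simp add: matrix_vector_mult_def vec_eq_iff column_def axis_def if_distrib cong: if_cong)

lemma column_col_matrix [simp]: "column j (col_matrix f) = f j"
  by (simp add: column_def col_matrix_def vec_eq_iff)

lemma column_inject: "(\<And>j. column j A = column j A') \<Longrightarrow> A = A'"
  by (simp add: column_def vec_eq_iff)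

lemma column_mult: "column j (A ** A') = A *v column j (A' :: int ^ 'n ^ 'n)"
  by (simp only: matrix_vector_axis[symmetric] matrix_vector_mul_assoc)

lemma column_add: "column j (A + A') = column j A + column j (A' :: int ^ 'n ^ 'n)"
  by (simp add: column_def vec_eq_iff)

lemma matrix_scale: "A *v (k *s x) = k *s (A *v (x :: int ^ 'n))"
  by (simp add: matrix_vector_mult_def vec_eq_iff sum_distrib_left algebra_simps)

lemma matrix_add_rdistrib: "(A + A') ** C = A ** C + A' ** (C :: int ^ 'n ^ 'n)"
  by (simp add: matrix_matrix_mult_def vec_eq_iff sum.distrib algebra_simps)

lemma matrix_diff_ldistrib: "A ** (C - C') = A ** C - A ** (C' :: int ^ 'n ^ 'n)"
  by (simp add: matrix_matrix_mult_def vec_eq_iff sum_subtractf algebra_simps)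

lemma matrix_diff_rdistrib: "(A - A') ** C = A ** C - A' ** (C :: int ^ 'n ^ 'n)"
  by (simp add: matrix_matrix_mult_def vec_eq_iff sum_subtractf algebra_simps)

text \<open>Turns membership in a span into a coefficient vector, from which the matrix of a column
  step is assembled. The support condition records which columns act as sources.\<close>

lemma int_span_union_decomp:
  assumes "x \<in> int_span (f ` K \<union> G)"
  shows "\<exists>a :: int ^ 'n. (\<forall>k. k \<notin> K \<longrightarrow> a $ k = 0) \<and> x - col_matrix f *v a \<in> int_span G"
  using assms
proof induction
  case (int_span_base x)
  show ?case
  proof (cases "x \<in> G")
    case True
    then show ?thesis by (intro exI[of _ 0]) (simp add: int_span.int_span_base)
  next
    case False
    then obtain k where "k \<in> K" "x = f k" using int_span_base by blast
    then show ?thesis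
      by (intro exI[of _ "axis k 1"] conjI allI impI)
        (use \<open>k \<in> K\<close> in \<open>simp add: axis_def, blast\<close>, simp add: matrix_vector_axis int_span_zero)
  qed
next
  case int_span_zero
  show ?case by (intro exI[of _ 0]) (simp add: int_span.int_span_zero)
next
  case (int_span_diff x y)
  then obtain a b where
    a: "\<forall>k. k \<notin> K \<longrightarrow> a $ k = 0" "x - col_matrix f *v a \<in> int_span G" and
    b: "\<forall>k. k \<notin> K \<longrightarrow> b $ k = 0" "y - col_matrix f *v b \<in> int_span G" by blast
  have "(x - y) - col_matrix f *v (a - b) = (x - col_matrix f *v a) - (y - col_matrix f *v b)"
    by (simp add: matrix_vector_mult_diff_distrib)
  then have "(x - y) - col_matrix f *v (a - b) \<in> int_span G"
    using int_span.int_span_diff[OF a(2) b(2)] by metis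
  then show ?case using a(1) b(1) by (intro exI[of _ "a - b"]) auto
qed

lemma int_span_matrix:
  assumes "\<And>j. column j X \<in> int_span G"
  shows "X *v a \<in> int_span G"
  unfolding matrix_mult_sum using assms by (intro int_span_sum int_span_scale)

lemma invertible_mat_1: "invertible (mat 1 :: int ^ 'n ^ 'n)"
  unfolding invertible_def by (intro exI[of _ "mat 1"]) simp

lemma invertible_product:
  fixes A A' :: "int ^ 'n ^ 'n"
  assumes "invertible A" "invertible A'"
  shows "invertible (A ** A')"
proof -
  obtain C C' where C: "A ** C = mat 1" "C ** A = mat 1" "A' ** C' = mat 1" "C' ** A' = mat 1"
    using assms unfolding invertible_def by blast
  have "(A ** A') ** (C' ** C) = A ** (A' ** C') ** C" "(C' ** C) ** (A ** A') = C' ** (C ** A) ** A'"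
    by (simp_all only: matrix_mul_assoc)
  then show ?thesis unfolding invertible_def using C by (intro exI[of _ "C' ** C"]) simp
qed

text \<open>The coefficient matrix \<open>A\<close> has nonzero entries only in source rows and
  target columns. Hence \<open>A ** A = 0\<close>, so \<open>mat 1 + A\<close> has inverse
  \<open>mat 1 - A\<close>; the correction \<open>X\<close> lives in target columns, so
  \<open>X ** A = 0\<close> and it may stand before the multiplication.\<close>

lemma col_step_matrix:
  fixes f f' :: "'n::finite \<Rightarrow> int ^ 'n"
  assumes "col_step G UNIV f f'"
  shows "\<exists>P X. invertible P \<and> (\<forall>j. column j X \<in> int_span G) \<and>
    col_matrix f' = (col_matrix f + X) ** P"
proof -
  obtain T where T: "\<And>j. j \<in> T \<Longrightarrow> f' j - f j \<in> int_span (f ` (- T) \<union> G)"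
    "\<And>j. j \<notin> T \<Longrightarrow> f' j = f j"
    by (rule col_stepE[OF assms, unfolded Compl_eq_Diff_UNIV[symmetric]]) (rule that; assumption)
  have "\<exists>a. (\<forall>k. k \<in> T \<or> j \<notin> T \<longrightarrow> a $ k = 0) \<and> f' j - f j - col_matrix f *v a \<in> int_span G \<and>
      (j \<notin> T \<longrightarrow> f' j - f j - col_matrix f *v a = 0)" for j
  proof (cases "j \<in> T")
    case True
    then show ?thesis using int_span_union_decomp[OF T(1)[OF True]] by fastforce
  next
    case False
    then show ?thesis using T(2) by (intro exI[of _ 0]) (simp add: int_span_zero)
  qed
  then obtain a where a: "\<And>j k. k \<in> T \<or> j \<notin> T \<Longrightarrow> a j $ k = 0"
    "\<And>j. f' j - f j - col_matrix f *v a j \<in> int_span G"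
    "\<And>j. j \<notin> T \<Longrightarrow> f' j - f j - col_matrix f *v a j = 0" by metis
  define A where "A = col_matrix a"
  define X where "X = col_matrix (\<lambda>j. f' j - f j - col_matrix f *v a j)"
  \<comment> \<open>The rows of \<open>A\<close> indexed by \<open>T\<close> are zero, so only
    columns of \<open>Y\<close> outside \<open>T\<close> can contribute to the product.\<close>
  have kill: "Y ** A = 0" if "\<And>j. j \<notin> T \<Longrightarrow> column j Y = 0" for Y :: "int ^ 'n ^ 'n"
  proof (rule column_inject)
    fix j
    have "column k Y = 0 \<or> a j $ k = 0" for k using that[of k] a(1)[of k j] by blast
    then have "Y *v a j = 0" unfolding matrix_mult_sum by (intro sum.neutral) auto
    then show "column j (Y ** A) = column j 0"
      by (simp add: A_def column_mult) (simp add: column_def vec_eq_iff)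
  qed
  have "a j = 0" if "j \<notin> T" for j using a(1)[of _ j] that by (simp add: vec_eq_iff)
  then have AA: "A ** A = 0" by (intro kill) (simp add: A_def)
  have XA: "X ** A = 0" using a(3) by (intro kill) (simp add: X_def)
  have "(mat 1 + A) ** (mat 1 - A) = mat 1" "(mat 1 - A) ** (mat 1 + A) = mat 1"
    by (simp_all add: matrix_add_ldistrib matrix_add_rdistrib matrix_diff_ldistrib matrix_diff_rdistrib AA)
  then have "invertible (mat 1 + A)" unfolding invertible_def by blast
  moreover have "column j X \<in> int_span G" for j using a(2) by (simp add: X_def)
  moreover have "col_matrix f' = (col_matrix f + X) ** (mat 1 + A)"
  proof -
    have "(col_matrix f + X) ** (mat 1 + A) = col_matrix f + X + col_matrix f ** A"
      using XA by (simp add: matrix_add_ldistrib matrix_add_rdistrib)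
    also have "\<dots> = col_matrix f'"
      by (rule column_inject) (simp add: column_add column_mult A_def X_def)
    finally show ?thesis by simp
  qed
  ultimately show ?thesis by blast
qed

text \<open>A correction made after \<open>P\<close> is carried back through \<open>P\<close> by its
  inverse, so that all corrections collect to the left of a single unimodular factor.\<close>

lemma col_steps_matrix:
  fixes f f' :: "'n::finite \<Rightarrow> int ^ 'n"
  assumes "(col_step G UNIV)\<^sup>*\<^sup>* f f'"
  shows "\<exists>P X. invertible P \<and> (\<forall>j. column j X \<in> int_span G) \<and>
    col_matrix f' = (col_matrix f + X) ** P"
  using assms
proof induction
  case base
  have "column j (0 :: int ^ 'n ^ 'n) \<in> int_span G" for j
    by (metis (no_types) column_def int_span_zero vec_eq_iff vec_lambda_beta zero_index)
  then show ?case using invertible_mat_1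
    by - (rule exI[where x = "mat 1"], rule exI[where x = 0], simp)
next
  case (step g h)
  obtain P X where PX: "invertible P" "\<And>j. column j X \<in> int_span G"
    "col_matrix g = (col_matrix f + X) ** P" using step.IH by blast
  obtain P' X' where PX': "invertible P'" "\<And>j. column j X' \<in> int_span G"
    "col_matrix h = (col_matrix g + X') ** P'" using col_step_matrix[OF step(2)] by blast
  obtain R where R: "P ** R = mat 1" "R ** P = mat 1" using PX(1) unfolding invertible_def by blast
  have "X' = X' ** R ** P" using R(2) by (simp flip: matrix_mul_assoc)
  then have "col_matrix g + X' = (col_matrix f + (X + X' ** R)) ** P"
    using PX(3) by (simp add: matrix_add_rdistrib add.assoc)
  then have "col_matrix h = (col_matrix f + (X + X' ** R)) ** (P ** P')"
    using PX'(3) by (simp add: matrix_mul_assoc)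
  moreover have "column j (X + X' ** R) \<in> int_span G" for j
    unfolding column_add column_mult by (intro int_span_add PX(2) int_span_matrix PX'(2))
  ultimately show ?case using invertible_product[OF PX(1) PX'(1)] by blast
qed

section \<open>Subgroups of the integers\<close>

text \<open>In a nonzero subgroup the least positive element divides all others: a nonzero remainder
  would be a smaller positive element.\<close>

lemma int_subgroup_generator:
  fixes H :: "int set"
  assumes "0 \<in> H" "\<And>x y. x \<in> H \<Longrightarrow> y \<in> H \<Longrightarrow> x - y \<in> H"
  shows "\<exists>d \<in> H. d \<ge> 0 \<and> (\<forall>h \<in> H. d dvd h)"
proof (cases "H = {0}")
  case True
  then show ?thesis by auto
next
  case False
  have neg: "- x \<in> H" if "x \<in> H" for x using assms(2)[OF assms(1) that] by simp
  have mult: "int n * x \<in> H" if "x \<in> H" for n x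
  proof (induction n)
    case (Suc n)
    have "int n * x - (- x) \<in> H" using Suc neg[OF that] assms(2) by blast
    then show ?case by (simp add: algebra_simps)
  qed (use assms in simp)
  have multi: "k * x \<in> H" if "x \<in> H" for k x
    using mult[OF that, of "nat k"] neg[OF mult[OF that, of "nat (- k)"]] by (cases "k \<ge> 0") auto
  obtain x where "x \<in> H" "x \<noteq> 0" using False assms(1) by blast
  then have "\<exists>n. 0 < n \<and> int n \<in> H" using neg by (intro exI[of _ "nat \<bar>x\<bar>"]) (auto simp: abs_if)
  then obtain n where n: "0 < n" "int n \<in> H" "\<And>m. 0 < m \<Longrightarrow> int m \<in> H \<Longrightarrow> n \<le> m"
    using exists_least_iff[of "\<lambda>n. 0 < n \<and> int n \<in> H"] by (metis not_less)
  have "int n dvd h" if "h \<in> H" for h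
  proof (rule ccontr)
    assume "\<not> int n dvd h"
    then have pos: "h mod int n > 0" using n(1)
      by (metis dvd_eq_mod_eq_0 less_le of_nat_0_less_iff pos_mod_sign)
    have "h - (h div int n) * int n \<in> H" using that multi[OF n(2)] assms(2) by blast
    then have "int (nat (h mod int n)) \<in> H" using pos by (simp add: minus_div_mult_eq_mod)
    then have "n \<le> nat (h mod int n)" using n(3) pos by simp
    then show False using pos_mod_bound[of "int n" h] n(1) by linarith
  qed
  then show ?thesis using n(2) by (intro bexI[of _ "int n"]) auto
qed

section \<open>Primitive vectors and determinants\<close>

definition dot :: "int ^ 'n \<Rightarrow> int ^ 'n \<Rightarrow> int" where
  "dot p x = (\<Sum>i\<in>UNIV. p $ i * x $ i)"

lemma dot_linear:
  "dot (p + q) x = dot p x + dot q x" "dot (p - q) x = dot p x - dot q x" "dot (k *s p) x = k * dot p x"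
  "dot p (x + y) = dot p x + dot p y" "dot p (x - y) = dot p x - dot p y" "dot p (k *s x) = k * dot p x"
  by (simp_all add: dot_def sum.distrib sum_subtractf sum_distrib_left algebra_simps)

lemma dot_zero [simp]: "dot 0 x = 0" "dot p 0 = 0"
  by (simp_all add: dot_def)

lemma dot_axis: "dot (axis i 1) x = x $ i"
  by (simp add: dot_def axis_def if_distrib[of "\<lambda>c. c * _"] cong: if_cong)

lemma gcd_mat_dvd: "gcd_mat B dvd B $ i $ j"
  unfolding gcd_mat_def by (rule Gcd_dvd) blast

lemma gcd_mat_dvd_mult: "gcd_mat B dvd (B *v z) $ i"
  unfolding matrix_vector_mult_def by (auto intro!: dvd_sum dvd_mult2 gcd_mat_dvd)

text \<open>The pair \<open>(p, z)\<close> minimises the positive values of \<open>p \<cdot> B z\<close>.\<close>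

lemma primitive_vector_in_colspace:
  fixes B :: "int ^ 'n ^ 'n"
  shows "\<exists>p w z. dot p w = 1 \<and> B *v z = gcd_mat B *s w"
proof (cases "B = 0")
  case True
  then have "gcd_mat B = 0" unfolding gcd_mat_def by (auto simp: Gcd_0_iff)
  then show ?thesis
    by (intro exI[of _ "axis undefined 1"] exI[of _ 0]) (simp add: dot_axis)
next
  case False
  define val where "val = (\<lambda>n. 0 < n \<and> (\<exists>p z. dot p (B *v z) = int n))"
  obtain i j where ij: "B $ i $ j \<noteq> 0" using False by (auto simp: vec_eq_iff)
  have "dot (sgn (B $ i $ j) *s axis i 1) (B *v axis j 1) = int (nat \<bar>B $ i $ j\<bar>)"
    by (simp add: dot_linear dot_axis matrix_vector_axis column_def sgn_if)
  then have "val (nat \<bar>B $ i $ j\<bar>)" unfolding val_def using ij by auto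
  then obtain n where n: "val n" "\<And>m. val m \<Longrightarrow> n \<le> m"
    using exists_least_iff[of val] by (metis not_less)
  define d where "d = int n"
  have d: "d > 0" using n(1) by (simp add: val_def d_def)
  obtain p z where pz: "dot p (B *v z) = d" using n(1) by (auto simp: val_def d_def)
  \<comment> \<open>Minimality of \<open>d\<close> means that a group of attained values containing
    \<open>d\<close> is generated by \<open>d\<close>: its generator divides \<open>d\<close> and is
    itself a positive attained value.\<close>
  have least: "d dvd h" if H: "d \<in> H" "h \<in> H" "0 \<in> H" "\<And>x y. x \<in> H \<Longrightarrow> y \<in> H \<Longrightarrow> x - y \<in> H"
    "\<And>x. x \<in> H \<Longrightarrow> \<exists>q y. dot q (B *v y) = x" for h H
  proof -
    obtain e where e: "e \<in> H" "e \<ge> 0" "\<And>h. h \<in> H \<Longrightarrow> e dvd h"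
      using int_subgroup_generator[OF H(3,4)] by blast
    have "e > 0" using e(2) e(3)[OF H(1)] d by (cases "e = 0") auto
    then have "val (nat e)" unfolding val_def using H(5)[OF e(1)] by simp
    then have "d \<le> e" using n(2)[OF \<open>val (nat e)\<close>] e(2) by (simp add: d_def)
    moreover have "e \<le> d" using e(3)[OF H(1)] d by (simp add: zdvd_imp_le)
    ultimately show ?thesis using e(3)[OF H(2)] by simp
  qed
  \<comment> \<open>With either argument of the pairing fixed, the attained values form a
    subgroup.\<close>
  have dvd_left: "d dvd dot q (B *v y)" if "dot p' (B *v y) = d" for p' q y
    by (rule least[of "range (\<lambda>q. dot q (B *v y))"])
      (use that in \<open>auto simp flip: dot_linear intro: range_eqI[of _ _ 0]\<close>)
  have dvd_right: "d dvd dot q (B *v y)" if "dot q (B *v z') = d" for q y z'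
  proof (rule least[of "range (\<lambda>y. dot q (B *v y))"])
    show "a - b \<in> range (\<lambda>y. dot q (B *v y))"
      if "a \<in> range (\<lambda>y. dot q (B *v y))" "b \<in> range (\<lambda>y. dot q (B *v y))" for a b
      using that by (auto simp flip: dot_linear matrix_vector_mult_diff_distrib)
    show "0 \<in> range (\<lambda>y. dot q (B *v y))" by (rule range_eqI[of _ _ 0]) simp
  qed (use that in auto)
  define w where "w = (\<chi> i. (B *v z) $ i div d)"
  have "d dvd (B *v z) $ i" for i using dvd_left[OF pz, of "axis i 1"] by (simp add: dot_axis)
  then have w: "B *v z = d *s w" by (simp add: w_def vec_eq_iff)
  then have pw: "dot p w = 1" using pz d by (simp add: dot_linear)
  have all: "d dvd dot q (B *v y)" for q y
  proof -
    \<comment> \<open>\<open>y'\<close> is \<open>y\<close> shifted by a multiple of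
      \<open>z\<close> so that \<open>p\<close> vanishes on \<open>B *v y'\<close>, and
      \<open>q'\<close> is \<open>q\<close> shifted by a multiple of \<open>p\<close> so that it
      pairs to 1 with \<open>w\<close>. Then \<open>q'\<close> and \<open>z\<close> again attain
      \<open>d\<close>, while \<open>q\<close> and \<open>q'\<close> agree on
      \<open>B *v y'\<close>.\<close>
    define k where "k = dot p (B *v y) div d"
    define y' where "y' = y - k *s z"
    define q' where "q' = q - dot q w *s p + p"
    have "d dvd dot p (B *v y)" using dvd_right[OF pz] .
    then have y': "dot p (B *v y') = 0"
      by (simp add: y'_def k_def matrix_vector_mult_diff_distrib matrix_scale dot_linear pz)
    have "dot q' (B *v z) = d" by (simp add: q'_def w dot_linear pw)
    then have "d dvd dot q' (B *v y')" by (rule dvd_right)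
    then have "d dvd dot q (B *v y')" using y' by (simp add: q'_def dot_linear)
    moreover have "dot q (B *v y) = dot q (B *v y') + k * dot q w * d"
      by (simp add: y'_def matrix_vector_mult_diff_distrib matrix_scale dot_linear w)
    ultimately show ?thesis by simp
  qed
  have "d dvd B $ i $ j" for i j
    using all[of "axis i 1" "axis j 1"] by (simp add: dot_axis matrix_vector_axis column_def)
  then have "d dvd gcd_mat B" unfolding gcd_mat_def by (auto intro: Gcd_greatest)
  moreover have "gcd_mat B dvd d"
    unfolding pz[symmetric] dot_def by (auto intro!: dvd_sum dvd_mult gcd_mat_dvd_mult)
  moreover have "gcd_mat B \<ge> 0" unfolding gcd_mat_def by simp
  ultimately have "gcd_mat B = d" using d by (simp add: zdvd_antisym_nonneg)
  then show ?thesis using w pw by metis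
qed

lemma invertible_transpose:
  fixes P :: "int ^ 'n ^ 'n"
  assumes "invertible P"
  shows "invertible (transpose P)"
  using assms unfolding invertible_def by (metis matrix_transpose_mul transpose_mat)

lemma int_span_empty: "int_span {} = {0}"
proof -
  have "x = 0" if "x \<in> int_span {}" for x using that by induction auto
  then show ?thesis using int_span_zero by blast
qed

text \<open>The entries of \<open>w\<close>, written as row \<open>i\<close> of an otherwise zero
  matrix, are reduced to a unit row by column operations; transposing the operation matrix gives
  \<open>Q\<close>. Dimension one is treated apart because the reduction requires a spare column;
  there \<open>w\<close> is a unit.\<close>

lemma primitive_to_axis:
  fixes w :: "int ^ 'n"
  assumes pw: "dot p w = 1"
  shows "\<exists>Q :: int ^ 'n ^ 'n. invertible Q \<and> Q *v w = axis i 1"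
proof (cases "(UNIV :: 'n set) = {i}")
  case True
  then have j: "j = i" for j :: 'n by blast
  have "p $ i * w $ i = 1" using pw by (simp add: dot_def True)
  then have w: "w $ i * w $ i = 1" by (metis mult_cancel_left1 mult_minus1_right zmult_eq_1_iff minus_minus)
  have "(mat (w $ i) ** mat (w $ i)) $ k $ l = (mat 1 :: int ^ 'n ^ 'n) $ k $ l"
    "(mat (w $ i) *v w) $ k = axis i 1 $ k" for k l
    using w j[of k] j[of l]
    by (simp_all add: matrix_matrix_mult_def matrix_vector_mult_def mat_def axis_def True)
  then have "mat (w $ i) ** mat (w $ i) = (mat 1 :: int ^ 'n ^ 'n)" "mat (w $ i) *v w = axis i 1"
    by (simp_all add: vec_eq_iff)
  then show ?thesis unfolding invertible_def by blast
next
  case False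
  define f where "f = (\<lambda>j. axis i (w $ j) :: int ^ 'n)"
  have "{i} \<subset> UNIV" using False by blast
  moreover have "\<exists>x \<in> int_span (f ` UNIV \<union> {}). \<forall>k \<in> {i}. x $ k = v $ k" for v :: "int ^ 'n"
  proof
    \<comment> \<open>The vector \<open>p\<close> provides Bezout coefficients for the entries of
      \<open>w\<close>.\<close>
    show "(\<Sum>j\<in>UNIV. (v $ i * p $ j) *s f j) \<in> int_span (f ` UNIV \<union> {})"
      by (intro int_span_sum int_span_scale int_span_base) simp
    have "(\<Sum>j\<in>UNIV. v $ i * p $ j * w $ j) = v $ i"
      using pw unfolding dot_def by (metis (no_types, lifting) mult.assoc mult.right_neutral sum.cong sum_distrib_left)
    then show "\<forall>k \<in> {i}. (\<Sum>j\<in>UNIV. (v $ i * p $ j) *s f j) $ k = v $ k" by (simp add: f_def)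
  qed
  ultimately obtain f' where f': "(col_step {} UNIV)\<^sup>*\<^sup>* f f'" "\<forall>j. f' j $ i = (if j = i then 1 else 0)"
    using reduce_columns[of "{i}" UNIV f "{}"] by auto
  obtain P X where P: "invertible P" "\<And>j. column j X \<in> int_span {}" "col_matrix f' = (col_matrix f + X) ** P"
    using col_steps_matrix[OF f'(1)] by blast
  have "X = 0" using P(2) unfolding int_span_empty by (intro column_inject) (simp add: column_def vec_eq_iff)
  then have P': "col_matrix f ** P = col_matrix f'" using P(3) by simp
  have "(transpose P *v w) $ j = axis i 1 $ j" for j
  proof -
    have "(transpose P *v w) $ j = (col_matrix f ** P) $ i $ j"
      by (simp add: matrix_vector_mult_def matrix_matrix_mult_def transpose_def col_matrix_def f_def mult.commute)
    also have "\<dots> = f' j $ i" unfolding P' by (simp add: col_matrix_def)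
    finally show ?thesis using f'(2) by (simp add: axis_def)
  qed
  then have "transpose P *v w = axis i 1" by (simp add: vec_eq_iff)
  then show ?thesis using invertible_transpose[OF P(1)] by blast
qed

section \<open>Determinants of integer matrices\<close>

text \<open>A permutation fixing every index except possibly \<open>i\<close> also fixes
  \<open>i\<close>. Every other permutation thus moves some \<open>k \<noteq> i\<close> and picks a
  zero entry in that row.\<close>

lemma det_unit_rows:
  fixes A :: "int ^ 'n ^ 'n"
  assumes "\<And>k j. k \<noteq> i \<Longrightarrow> A $ k $ j = (if j = k then 1 else 0)"
  shows "det A = A $ i $ i"
proof -
  have "(\<Prod>k\<in>UNIV. A $ k $ \<pi> k) = 0" if \<pi>: "\<pi> permutes UNIV" "\<pi> \<noteq> id" for \<pi>
  proof -
    have "\<exists>k. k \<noteq> i \<and> \<pi> k \<noteq> k"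
    proof (rule ccontr)
      assume "\<not> ?thesis"
      then have fixed: "\<pi> k = k" if "k \<noteq> i" for k using that by blast
      moreover have "\<pi> i = i" using fixed permutes_inj[OF \<pi>(1)] by (metis injD)
      ultimately have "\<pi> = id" by (metis eq_id_iff)
      then show False using \<pi>(2) by simp
    qed
    then obtain k where "k \<noteq> i" "\<pi> k \<noteq> k" by blast
    then have "A $ k $ \<pi> k = 0" using assms by simp
    then show ?thesis by (metis UNIV_I finite prod_zero)
  qed
  then have "det A = (\<Sum>\<pi>\<in>{id}. of_int (sign \<pi>) * (\<Prod>k\<in>UNIV. A $ k $ \<pi> k))"
    unfolding det_def by (intro sum.mono_neutral_right) (auto simp: permutes_id finite_permutations)
  also have "\<dots> = (\<Prod>k\<in>UNIV. A $ k $ k)" by (simp add: sign_id)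
  also have "\<dots> = A $ i $ i * (\<Prod>k\<in>UNIV - {i}. A $ k $ k)" by (rule prod.remove) auto
  also have "(\<Prod>k\<in>UNIV - {i}. A $ k $ k) = 1" using assms by (intro prod.neutral) auto
  finally show ?thesis by simp
qed

lemma det_cong:
  fixes A C :: "int ^ 'n ^ 'n"
  assumes "\<And>i j. [A $ i $ j = C $ i $ j] (mod m)"
  shows "[det A = det C] (mod m)"
  unfolding det_def by (intro cong_sum cong_mult cong_refl cong_prod assms)

lemma det_invertible:
  fixes A :: "int ^ 'n ^ 'n"
  assumes "invertible A"
  shows "det A = 1 \<or> det A = -1"
  using assms unfolding invertible_def by (metis det_I det_mul zmult_eq_1_iff)

section \<open>Unimodular lifts\<close>

lemma int_span_colspace: "int_span (colspace B) = colspace B"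
proof
  have diff: "x - y \<in> colspace B" if "x \<in> colspace B" "y \<in> colspace B" for x y
    using that unfolding colspace_def by (auto simp flip: matrix_vector_mult_diff_distrib)
  have "0 \<in> colspace B" unfolding colspace_def by (rule range_eqI[of _ _ 0]) simp
  then show "int_span (colspace B) \<subseteq> colspace B" using diff by (auto elim: int_span_closed)
qed (auto intro: int_span_base)

lemma columns_in_colspace:
  fixes B X :: "int ^ 'n ^ 'n"
  assumes "\<And>j. column j X \<in> colspace B"
  shows "\<exists>Y. X = B ** Y"
proof -
  have "\<forall>j. \<exists>y. column j X = B *v y" using assms unfolding colspace_def by blast
  then obtain y where "\<And>j. column j X = B *v y j" by metis
  then have "X = B ** col_matrix y" by (intro column_inject) (simp add: column_mult)
  then show ?thesis ..
qed

text \<open>After a change of basis, \<open>\<delta> e\<^sub>i\<close> lies in the column space of \<open>B\<close>. Reducing all coordinates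
  other than \<open>i\<close> leaves a matrix whose determinant is its entry \<open>(i, i)\<close>, which may then be changed
  by multiples of \<open>\<delta>\<close>.\<close>

lemma unimodular_lift:
  fixes B M :: "int ^ 'n ^ 'n"
  assumes span: "\<And>x. \<exists>y z. x = M *v y + B *v z"
    and detM: "[det M = 1] (mod gcd_mat B) \<or> [det M = -1] (mod gcd_mat B)"
  shows "\<exists>Y. invertible (M + B ** Y)"
proof -
  define \<delta> where "\<delta> = gcd_mat B"
  obtain i :: 'n where True by blast
  obtain p w z where w: "dot p w = 1" "B *v z = \<delta> *s w"
    using primitive_vector_in_colspace[of B] unfolding \<delta>_def by blast
  obtain Q :: "int ^ 'n ^ 'n" where Q: "invertible Q" "Q *v w = axis i 1"
    using primitive_to_axis[OF w(1)] by blast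
  obtain Q' where Q': "Q ** Q' = mat 1" "Q' ** Q = mat 1" using Q(1) unfolding invertible_def by blast
  define G where "G = colspace (Q ** B)"
  define f where "f = (\<lambda>j. column j (Q ** M))"
  have fM: "col_matrix f = Q ** M" by (rule column_inject) (simp add: f_def)
  have G: "int_span G = G" unfolding G_def by (rule int_span_colspace)
  have "\<exists>x \<in> int_span (f ` UNIV \<union> G). \<forall>k \<in> - {i}. x $ k = v $ k" for v
  proof -
    obtain y z where yz: "Q' *v v = M *v y + B *v z" using span by blast
    have "v = Q *v (Q' *v v)" by (simp add: matrix_vector_mul_assoc Q')
    also have "\<dots> = (Q ** M) *v y + (Q ** B) *v z"
      by (simp add: yz matrix_vector_right_distrib matrix_vector_mul_assoc)
    also have "(Q ** M) *v y \<in> int_span (f ` UNIV \<union> G)"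
      by (rule int_span_matrix) (auto simp: f_def intro: int_span_base)
    then have "(Q ** M) *v y + (Q ** B) *v z \<in> int_span (f ` UNIV \<union> G)"
      by (rule int_span_add) (auto simp: G_def colspace_def intro: int_span_base)
    finally show ?thesis by blast
  qed
  moreover have "- {i} \<subset> UNIV" by auto
  ultimately obtain f1 where f1: "(col_step G UNIV)\<^sup>*\<^sup>* f f1"
    and "\<forall>k \<in> - {i}. \<forall>j \<in> UNIV. f1 j $ k = (if j = k then 1 else 0)"
    using reduce_columns[of "- {i}" UNIV f G] by blast
  then have f1_rows: "f1 j $ k = (if j = k then 1 else 0)" if "k \<noteq> i" for j k using that by simp
  \<comment> \<open>Every matrix reached from \<open>Q ** M\<close> comes from some
    \<open>M + B ** Y\<close> by unimodular factors, so it suffices to reach an invertible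
    one.\<close>
  have lift: "\<exists>P Y. invertible P \<and> col_matrix g = Q ** (M + B ** Y) ** P"
    if steps: "(col_step G UNIV)\<^sup>*\<^sup>* f g" for g
  proof -
    obtain P X where PX: "invertible P" "\<And>j. column j X \<in> G" "col_matrix g = (Q ** M + X) ** P"
      using col_steps_matrix[OF steps] unfolding fM G by blast
    obtain Y where "X = Q ** B ** Y" using columns_in_colspace PX(2) unfolding G_def by blast
    then have "col_matrix g = Q ** (M + B ** Y) ** P"
      using PX(3) by (simp add: matrix_add_ldistrib matrix_mul_assoc)
    then show ?thesis using PX(1) by blast
  qed
  define c where "c = f1 i $ i"
  have det1: "det (col_matrix f1) = c"
    unfolding c_def by (subst det_unit_rows[of i]) (auto simp: col_matrix_def f1_rows)
  obtain P Y where PY: "invertible P" "col_matrix f1 = Q ** (M + B ** Y) ** P" using lift[OF f1] by blast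
  have "[det (M + B ** Y) = det M] (mod \<delta>)"
  proof (rule det_cong)
    fix k l
    have "\<delta> dvd (B *v column l Y) $ k" unfolding \<delta>_def by (rule gcd_mat_dvd_mult)
    then have "\<delta> dvd (B ** Y) $ k $ l" by (metis column_def column_mult vec_lambda_beta)
    then show "[(M + B ** Y) $ k $ l = M $ k $ l] (mod \<delta>)" by (simp add: cong_iff_dvd_diff)
  qed
  then have cM: "[c = det Q * det M * det P] (mod \<delta>)"
    unfolding det1[symmetric] PY(2) det_mul by (intro cong_mult cong_refl)
  have "\<exists>\<epsilon>. (\<epsilon> = 1 \<or> \<epsilon> = -1) \<and> [c = \<epsilon>] (mod \<delta>)"
  proof -
    obtain \<epsilon> :: int where "\<epsilon> = 1 \<or> \<epsilon> = -1" "[det M = \<epsilon>] (mod \<delta>)" using detM unfolding \<delta>_def by blast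
    then show ?thesis using det_invertible[OF Q(1)] det_invertible[OF PY(1)]
      by (intro exI[of _ "det Q * \<epsilon> * det P"] conjI cong_trans[OF cM] cong_mult cong_refl) auto
  qed
  then obtain \<epsilon> k where \<epsilon>: "\<epsilon> = 1 \<or> \<epsilon> = -1" and k: "\<epsilon> = c + \<delta> * k"
    by (auto simp: cong_iff_lin)
  \<comment> \<open>The choice of \<open>Q\<close> makes \<delta> times the \<open>i\<close>-th unit
    vector a column combination of \<open>Q ** B\<close>; this is what allows the entry
    \<open>c\<close> to be shifted to \<epsilon>.\<close>
  have "k *s (\<delta> *s axis i 1) = (Q ** B) *v (k *s z)"
    by (simp add: matrix_scale w Q flip: matrix_vector_mul_assoc)
  then have "k *s (\<delta> *s axis i 1) \<in> G" unfolding G_def colspace_def by blast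
  then have f2: "col_step G UNIV f1 (f1(i := f1 i + k *s (\<delta> *s axis i 1)))" (is "col_step _ _ _ ?f2")
    by (intro col_step_upd) (auto intro: int_span_base)
  have f2i: "?f2 i = \<epsilon> *s axis i 1"
    using k by (auto simp: vec_eq_iff f1_rows axis_def c_def algebra_simps)
  \<comment> \<open>Since \<epsilon> is its own inverse, multiples of column \<open>i\<close> clear
    row \<open>i\<close> in all other columns. The result is diagonal with entries \<epsilon> and 1,
    hence an involution.\<close>
  define f3 where "f3 = (\<lambda>j. if j = i then ?f2 i else ?f2 j + - ((\<epsilon> * ?f2 j $ i) *s ?f2 i))"
  have "col_step G UNIV ?f2 f3"
    unfolding col_step_def
  proof (intro exI[of _ "- {i}"] conjI allI)
    have "- ((\<epsilon> * ?f2 j $ i) *s ?f2 i) \<in> int_span (?f2 ` (UNIV - - {i}) \<union> G)" for j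
      by (intro int_span_uminus int_span_scale int_span_base) simp
    then show "if j \<in> - {i} then f3 j - ?f2 j \<in> int_span (?f2 ` (UNIV - - {i}) \<union> G) else f3 j = ?f2 j" for j
      by (simp add: f3_def del: fun_upd_apply)
  qed simp
  then have "(col_step G UNIV)\<^sup>*\<^sup>* f f3" using f1 f2 by (meson rtranclp.rtrancl_into_rtrancl)
  then obtain P' Y' where PY': "invertible P'" "col_matrix f3 = Q ** (M + B ** Y') ** P'"
    using lift by blast
  have \<epsilon>2: "\<epsilon> * \<epsilon> = 1" using \<epsilon> by auto
  have f3: "f3 j = (if j = i then \<epsilon> else 1) *s axis j 1" for j
  proof (cases "j = i")
    case True
    then show ?thesis using f2i by (simp add: f3_def)
  next
    case False
    have "f3 j $ k = axis j 1 $ k" for k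
    proof (cases "k = i")
      case True
      then show ?thesis using False \<epsilon>2 unfolding f3_def f2i
        by (simp add: axis_def algebra_simps flip: mult.assoc)
    next
      case k: False
      then show ?thesis using False unfolding f3_def f2i by (simp add: f1_rows axis_def)
    qed
    then show ?thesis using False by (simp add: vec_eq_iff)
  qed
  have "col_matrix f3 ** col_matrix f3 = mat 1"
  proof (rule column_inject)
    fix j
    define e where "e = (if j = i then \<epsilon> else 1)"
    have "col_matrix f3 *v f3 j = e *s f3 j"
      by (subst f3) (simp add: matrix_scale matrix_vector_axis e_def)
    also have "\<dots> = axis j 1" using \<epsilon>2 by (simp add: f3 e_def)
    finally show "column j (col_matrix f3 ** col_matrix f3) = column j (mat 1)"
      by (simp add: column_mult) (simp flip: matrix_vector_axis)
  qed
  then have inv3: "invertible (col_matrix f3)" unfolding invertible_def by blast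
  obtain R where R: "P' ** R = mat 1" "R ** P' = mat 1" using PY'(1) unfolding invertible_def by blast
  have "Q' ** col_matrix f3 ** R = (Q' ** Q) ** (M + B ** Y') ** (P' ** R)"
    unfolding PY'(2) by (simp only: matrix_mul_assoc)
  then have "M + B ** Y' = Q' ** col_matrix f3 ** R" using R Q' by simp
  moreover have "invertible Q'" "invertible R" using Q' R unfolding invertible_def by blast+
  ultimately have "invertible (M + B ** Y')" using inv3 by (simp add: invertible_product)
  then show ?thesis by blast
qed

section \<open>Splitting off the kernel\<close>

text \<open>Induction on the coordinates that may be nonzero in \<open>G\<close>. An element
  \<open>u\<close> whose \<open>i\<close>-th coordinate divides all others splits each
  \<open>g\<close> into a multiple of \<open>u\<close> and a remainder vanishing at
  \<open>i\<close>; \<open>u\<close> is lifted to a chosen preimage, the remainder by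
  induction.\<close>

lemma colspace_section_aux:
  fixes B :: "int ^ 'n ^ 'n"
  assumes "finite S" "\<And>g i. g \<in> G \<Longrightarrow> i \<notin> S \<Longrightarrow> g $ i = 0"
    and "0 \<in> G" "\<And>x y. x \<in> G \<Longrightarrow> y \<in> G \<Longrightarrow> x - y \<in> G" "G \<subseteq> colspace B"
  shows "\<exists>s. (\<forall>x \<in> G. \<forall>y \<in> G. s (x + y) = s x + s y) \<and> (\<forall>x \<in> G. B *v s x = x)"
  using assms
proof (induction S arbitrary: G rule: finite_induct)
  case empty
  then have "x = 0" if "x \<in> G" for x using that by (simp add: vec_eq_iff)
  then show ?case by (intro exI[of _ "\<lambda>_. 0"]) force
next
  case (insert i S)
  define G0 where "G0 = {g \<in> G. g $ i = 0}"
  have "\<exists>d \<in> (\<lambda>g. g $ i) ` G. d \<ge> 0 \<and> (\<forall>h \<in> (\<lambda>g. g $ i) ` G. d dvd h)"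
  proof (rule int_subgroup_generator)
    show "0 \<in> (\<lambda>g. g $ i) ` G" using insert.prems(2) by force
    show "a - b \<in> (\<lambda>g. g $ i) ` G" if ab: "a \<in> (\<lambda>g. g $ i) ` G" "b \<in> (\<lambda>g. g $ i) ` G" for a b
    proof -
      obtain x y where "x \<in> G" "y \<in> G" "a = x $ i" "b = y $ i" using ab by blast
      then show ?thesis using insert.prems(3)[of x y] by (intro image_eqI[of _ _ "x - y"]) auto
    qed
  qed
  then obtain u where u: "u \<in> G" "\<And>g. g \<in> G \<Longrightarrow> u $ i dvd g $ i" by blast
  obtain z where z: "u = B *v z" using u(1) insert.prems(4) unfolding colspace_def by blast
  have "\<exists>s. (\<forall>x \<in> G0. \<forall>y \<in> G0. s (x + y) = s x + s y) \<and> (\<forall>x \<in> G0. B *v s x = x)"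
  proof (rule insert.IH)
    show "g $ k = 0" if "g \<in> G0" "k \<notin> S" for g k
      using that insert.prems(1)[of g k] by (cases "k = i") (auto simp: G0_def)
  qed (use insert.prems in \<open>auto simp: G0_def\<close>)
  then obtain s where s: "\<And>x y. x \<in> G0 \<Longrightarrow> y \<in> G0 \<Longrightarrow> s (x + y) = s x + s y"
    "\<And>x. x \<in> G0 \<Longrightarrow> B *v s x = x" by blast
  \<comment> \<open>If \<open>u $ i = 0\<close>, then all \<open>g $ i\<close> are 0 as well, and
    division by zero gives \<open>q g = 0\<close>, as the decomposition requires.\<close>
  define q where "q = (\<lambda>g. g $ i div u $ i)"
  define r where "r = (\<lambda>g. g - q g *s u)"
  have "r g \<in> G0" if "g \<in> G" for g
  proof -
    have "q g *s u \<in> int_span G" using u(1) by (intro int_span_scale int_span_base)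
    then have "q g *s u \<in> G" by (rule int_span_closed) (use insert.prems in auto)
    then show ?thesis using insert.prems(3)[OF that] u(2)[OF that] by (simp add: G0_def r_def q_def)
  qed
  note r = this
  have q: "q (x + y) = q x + q y" if "x \<in> G" for x y
    using u(2)[OF that] by (simp add: q_def div_plus_div_distrib_dvd_left)
  have r_add: "r (x + y) = r x + r y" if "x \<in> G" for x y
    using q[OF that] by (simp add: r_def vector_sadd_rdistrib)
  define t where "t = (\<lambda>g. q g *s z + s (r g))"
  have "t (x + y) = t x + t y" if "x \<in> G" "y \<in> G" for x y
    unfolding t_def q[OF that(1)] r_add[OF that(1)] s(1)[OF r[OF that(1)] r[OF that(2)]]
    by (simp add: vector_sadd_rdistrib)
  moreover have "B *v t x = x" if "x \<in> G" for x
    unfolding t_def using s(2)[OF r[OF that]] by (simp add: matrix_vector_right_distrib matrix_scale z[symmetric] r_def)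
  ultimately show ?case by blast
qed

lemma colspace_section:
  fixes B :: "int ^ 'n ^ 'n"
  obtains s where "\<And>x y. s (B *v x + B *v y) = s (B *v x) + s (B *v y)" "\<And>x. B *v s (B *v x) = B *v x"
proof -
  have "\<exists>s. (\<forall>x \<in> colspace B. \<forall>y \<in> colspace B. s (x + y) = s x + s y) \<and> (\<forall>x \<in> colspace B. B *v s x = x)"
  proof (rule colspace_section_aux[of UNIV])
    show "0 \<in> colspace B" using int_span_zero[of "colspace B"] int_span_colspace by blast
    show "x - y \<in> colspace B" if "x \<in> colspace B" "y \<in> colspace B" for x y
      using that int_span_diff[of x "colspace B" y] unfolding int_span_colspace by blast
  qed auto
  then obtain s where s: "\<forall>x \<in> colspace B. \<forall>y \<in> colspace B. s (x + y) = s x + s y"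
    "\<forall>x \<in> colspace B. B *v s x = x" by blast
  have "B *v x \<in> colspace B" for x unfolding colspace_def by blast
  then show thesis using s that by blast
qed

lemma additive_matrix:
  fixes h :: "int ^ 'n \<Rightarrow> int ^ 'n"
  assumes add: "\<And>x y. h (x + y) = h x + h y"
  shows "\<exists>W. \<forall>x. h x = W *v x"
proof -
  have h0: "h 0 = 0" using add[of 0 0] by simp
  have sub: "h (x - y) = h x - h y" for x y using add[of "x - y" y] by simp
  have scale: "h (k *s x) = k *s h x" for k x
  proof (induction k rule: int_induct[where k = 0])
    case base
    then show ?case by (simp add: h0)
  qed (simp_all add: vector_sadd_rdistrib vector_sub_rdistrib add sub)
  have sum: "h (\<Sum>i\<in>I. g i) = (\<Sum>i\<in>I. h (g i))" for g and I :: "'n set"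
    by (induction I rule: infinite_finite_induct) (auto simp: h0 add)
  have "h x = col_matrix (\<lambda>i. h (axis i 1)) *v x" for x
    using sum[of "\<lambda>i. x $ i *s axis i 1" UNIV]
    by (simp add: basis_expansion scale matrix_mult_sum)
  then show ?thesis by blast
qed

lemma matrix_inv_eq:
  fixes V W :: "int ^ 'n ^ 'n"
  assumes "V ** W = mat 1" "W ** V = mat 1"
  shows "matrix_inv V = W"
proof -
  have "V ** matrix_inv V = mat 1 \<and> matrix_inv V ** V = mat 1"
    unfolding matrix_inv_def by (rule someI[of _ W]) (use assms in blast)
  then show ?thesis using assms by (metis matrix_mul_assoc matrix_mul_lid matrix_mul_rid)
qed

section \<open>Realising both automorphisms\<close>

lemma cok_class_eq_iff: "cok_class B x = cok_class B y \<longleftrightarrow> x - y \<in> colspace B"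
proof -
  have mem: "v \<in> cok_class B x \<longleftrightarrow> v - x \<in> colspace B" for v x
    by (auto simp: cok_class_def r_coset_def Zn_def) (metis diff_add_cancel)
  have zero: "0 \<in> colspace B" using int_span_zero[of "colspace B"] int_span_colspace by blast
  have diff: "x - y \<in> colspace B" if "x \<in> colspace B" "y \<in> colspace B" for x y
    using that int_span_diff[of x "colspace B" y] unfolding int_span_colspace by blast
  show ?thesis
  proof
    assume "cok_class B x = cok_class B y"
    then show "x - y \<in> colspace B" using mem[of x x] mem[of x y] zero by simp
  next
    assume xy: "x - y \<in> colspace B"
    have "v - x \<in> colspace B \<longleftrightarrow> v - y \<in> colspace B" for v
      using diff[OF _ diff[OF zero xy], of "v - x"] diff[OF _ xy, of "v - y"] by auto
    then show "cok_class B x = cok_class B y" using mem by blast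
  qed
qed

lemma carrier_cok: "carrier (cok B) = range (cok_class B)"
  by (auto simp: cok_def FactGroup_def RCOSETS_def cok_class_def Zn_def)

text \<open>\<open>ker B\<close> is complemented by the image of the section \<open>s\<close>, so \<open>V\<^sup>-\<^sup>1\<close> may be prescribed
  independently on the two summands: as \<open>\<psi>\<close> on the first, as the conjugate of \<open>U\<close> on the second.\<close>

lemma kernel_extension:
  fixes B U :: "int ^ 'n ^ 'n"
  assumes U: "invertible U" "\<And>x. U *v x \<in> colspace B \<longleftrightarrow> x \<in> colspace B"
    and \<psi>: "\<psi> \<in> iso (kergrp B) (kergrp B)"
  shows "\<exists>V. invertible V \<and> U ** B ** V = B \<and> induces_ker B (matrix_inv V) \<psi>"
proof -
  obtain U' where U': "U ** U' = mat 1" "U' ** U = mat 1" using U(1) unfolding invertible_def by blast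
  obtain s where s: "\<And>x y. s (B *v x + B *v y) = s (B *v x) + s (B *v y)"
    "\<And>x. B *v s (B *v x) = B *v x" using colspace_section[of B] by metis
  have s0: "s 0 = 0" using s(1)[of 0 0] by simp
  define K where "K = {x. B *v x = 0}"
  define \<psi>' where "\<psi>' = inv_into K \<psi>"
  have bij: "bij_betw \<psi> K K" and add: "\<And>x y. x \<in> K \<Longrightarrow> y \<in> K \<Longrightarrow> \<psi> (x + y) = \<psi> x + \<psi> y"
    using \<psi> by (auto simp: iso_def hom_def kergrp_def K_def)
  have KI: "x - s (B *v x) \<in> K" for x by (simp add: K_def matrix_vector_mult_diff_distrib s)
  have Kadd: "x + y \<in> K" if "x \<in> K" "y \<in> K" for x y
    using that by (simp add: K_def matrix_vector_right_distrib)
  have in_K: "\<psi> x \<in> K" "\<psi>' x \<in> K" if "x \<in> K" for x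
    using bij that unfolding \<psi>'_def by (auto simp: bij_betw_def inv_into_into)
  have inv: "\<psi>' (\<psi> x) = x" "\<psi> (\<psi>' x) = x" if "x \<in> K" for x
    using bij that unfolding \<psi>'_def by (auto simp: bij_betw_def f_inv_into_f)
  have add': "\<psi>' (x + y) = \<psi>' x + \<psi>' y" if "x \<in> K" "y \<in> K" for x y
    using add[of "\<psi>' x" "\<psi>' y"] inv in_K that Kadd by metis
  \<comment> \<open>\<open>x - s (B *v x)\<close> is the kernel component of \<open>x\<close>, on
    which \<open>h\<close> acts; on the complementary component, identified with the image of
    \<open>B\<close> by \<open>s\<close>, the matrix \<open>A\<close> acts.\<close>
  define ext where "ext = (\<lambda>h A x. h (x - s (B *v x)) + s (A *v (B *v x)) :: int ^ 'n)"
  \<comment> \<open>For \<open>U'\<close> this uses the converse direction of the assumed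
    equivalence, applied to \<open>U' *v (B *v x)\<close>.\<close>
  have A_im: "\<exists>y. A *v (B *v x) = B *v y" if "A = U \<or> A = U'" for A x
  proof -
    have "A *v (B *v x) \<in> colspace B"
      using that U(2)[of "B *v x"] U(2)[of "U' *v (B *v x)"] U'
      by (auto simp: matrix_vector_mul_assoc colspace_def matrix_mul_assoc)
    then show ?thesis unfolding colspace_def by blast
  qed
  have Bext: "B *v ext h A x = A *v (B *v x)"
    if "\<And>x. x \<in> K \<Longrightarrow> h x \<in> K" "A = U \<or> A = U'" for h A x
  proof -
    have "B *v s (A *v (B *v x)) = A *v (B *v x)" using A_im[OF that(2), of x] s(2) by metis
    moreover have "B *v h (x - s (B *v x)) = 0" using that(1)[OF KI] by (simp add: K_def)
    ultimately show ?thesis by (simp add: ext_def matrix_vector_right_distrib)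
  qed
  have ext_add: "ext h A (x + y) = ext h A x + ext h A y"
    if "\<And>x y. x \<in> K \<Longrightarrow> y \<in> K \<Longrightarrow> h (x + y) = h x + h y" "A = U \<or> A = U'" for h A x y
  proof -
    have "s (A *v (B *v (x + y))) = s (A *v (B *v x)) + s (A *v (B *v y))"
      using A_im[OF that(2), of x] A_im[OF that(2), of y] s(1) by (auto simp: matrix_vector_right_distrib)
    moreover have "(x + y) - s (B *v (x + y)) = (x - s (B *v x)) + (y - s (B *v y))"
      by (simp add: matrix_vector_right_distrib s(1))
    ultimately show ?thesis
      unfolding ext_def by (simp only: that(1)[OF KI KI]) (simp add: ac_simps)
  qed
  \<comment> \<open>Applying \<open>B\<close> recovers the image component and subtracting its
    section recovers the kernel component, so inverse data on the two summands give inverse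
    extensions.\<close>
  have ext_inv: "ext h' A' (ext h A x) = x"
    if h: "\<And>x. x \<in> K \<Longrightarrow> h x \<in> K" "\<And>x. x \<in> K \<Longrightarrow> h' (h x) = x"
      and A: "A = U \<or> A = U'" "A' ** A = mat 1" for h h' A A' x
  proof -
    have B: "B *v ext h A x = A *v (B *v x)" by (rule Bext[OF h(1) A(1)])
    then have "ext h A x - s (B *v ext h A x) = h (x - s (B *v x))" by (simp add: ext_def)
    then show ?thesis
      using h(2)[OF KI] by (subst ext_def) (simp add: B matrix_vector_mul_assoc A(2) matrix_mul_assoc)
  qed
  obtain W where W: "\<And>x. ext \<psi> U x = W *v x"
    using additive_matrix[of "ext \<psi> U"] ext_add[of \<psi> U] add by metis
  obtain V where V: "\<And>x. ext \<psi>' U' x = V *v x"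
    using additive_matrix[of "ext \<psi>' U'"] ext_add[of \<psi>' U'] add' by metis
  have eqI: "A = A'" if "\<And>x. A *v x = A' *v x" for A A' :: "int ^ 'n ^ 'n"
    by (rule column_inject) (metis matrix_vector_axis that)
  have VW: "V ** W = mat 1" "W ** V = mat 1"
    using ext_inv[of \<psi> \<psi>' U U'] ext_inv[of \<psi>' \<psi> U' U] in_K inv U'
    by (auto intro!: eqI simp: W V simp flip: matrix_vector_mul_assoc)
  \<comment> \<open>\<open>W\<close> is to be the inverse of \<open>V\<close>, so this intertwining
    relation is the required factorization of \<open>B\<close>.\<close>
  have "B ** W = U ** B"
    using Bext[of \<psi> U] in_K by (intro eqI) (simp add: W flip: matrix_vector_mul_assoc)
  then have "U ** B ** V = B ** (W ** V)" by (simp add: matrix_mul_assoc)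
  then have "U ** B ** V = B" using VW by simp
  moreover have "induces_ker B (matrix_inv V) \<psi>"
    unfolding induces_ker_def matrix_inv_eq[OF VW] W[symmetric] by (simp add: ext_def s0)
  moreover have "invertible V" unfolding invertible_def using VW by blast
  ultimately show ?thesis by blast
qed

theorem theorem4p1:
  fixes B M :: "int ^ 'n ^ 'n"
    and \<phi> :: "(int ^ 'n) set \<Rightarrow> (int ^ 'n) set"
    and \<psi> :: "int ^ 'n \<Rightarrow> int ^ 'n"
  assumes "\<phi> \<in> iso (cok B) (cok B)"
    and "\<psi> \<in> iso (kergrp B) (kergrp B)"
    and "induces_cok B M \<phi>"
  shows "([det M = 1] (mod gcd_mat B) \<or> [det M = -1] (mod gcd_mat B)) \<longleftrightarrow>
         (\<exists>U V :: int ^ 'n ^ 'n. invertible U \<and> invertible V \<and> U ** B ** V = B \<and>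
            induces_cok B U \<phi> \<and> induces_ker B (matrix_inv V) \<psi>)"
proof
  have \<phi>: "\<phi> (cok_class B x) = cok_class B (M *v x)" for x
    using assms(3) unfolding induces_cok_def by blast
  have bij: "bij_betw \<phi> (range (cok_class B)) (range (cok_class B))"
    using assms(1) by (simp add: iso_def carrier_cok)
  assume "[det M = 1] (mod gcd_mat B) \<or> [det M = -1] (mod gcd_mat B)"
  moreover have "\<exists>y z. x = M *v y + B *v z" for x
  proof -
    have "cok_class B x \<in> \<phi> ` range (cok_class B)" using bij by (simp add: bij_betw_def)
    then obtain y where "cok_class B x = cok_class B (M *v y)" using \<phi> by auto
    then obtain z where "x - M *v y = B *v z" unfolding cok_class_eq_iff colspace_def by blast
    then have "x = M *v y + B *v z" by (simp add: algebra_simps)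
    then show ?thesis by blast
  qed
  ultimately obtain Y where U: "invertible (M + B ** Y)" (is "invertible ?U")
    using unimodular_lift[of M B] by blast
  have "?U *v x - M *v x = B *v (Y *v x)" for x
    by (simp add: matrix_vector_mult_add_rdistrib matrix_vector_mul_assoc)
  then have "?U *v x - M *v x \<in> colspace B" for x unfolding colspace_def by (metis rangeI)
  then have U\<phi>: "\<phi> (cok_class B x) = cok_class B (?U *v x)" for x
    using \<phi> cok_class_eq_iff by metis
  \<comment> \<open>Membership in the column space means having the class of 0; injectivity of
    \<phi> lets this be reflected back from \<open>?U *v x\<close> to \<open>x\<close>.\<close>
  have "?U *v x \<in> colspace B \<longleftrightarrow> x \<in> colspace B" for x
  proof -
    have "?U *v x \<in> colspace B \<longleftrightarrow> \<phi> (cok_class B x) = \<phi> (cok_class B 0)"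
      unfolding U\<phi> by (simp add: cok_class_eq_iff)
    also have "\<dots> \<longleftrightarrow> cok_class B x = cok_class B 0"
      using bij by (auto simp: bij_betw_def dest: inj_onD)
    finally show ?thesis by (simp add: cok_class_eq_iff)
  qed
  then show "\<exists>U V :: int ^ 'n ^ 'n. invertible U \<and> invertible V \<and> U ** B ** V = B \<and>
            induces_cok B U \<phi> \<and> induces_ker B (matrix_inv V) \<psi>"
    using kernel_extension[OF U _ assms(2)] U U\<phi> unfolding induces_cok_def by blast
next
  assume "\<exists>U V :: int ^ 'n ^ 'n. invertible U \<and> invertible V \<and> U ** B ** V = B \<and>
            induces_cok B U \<phi> \<and> induces_ker B (matrix_inv V) \<psi>"
  then obtain U :: "int ^ 'n ^ 'n" where U: "invertible U" "induces_cok B U \<phi>" by blast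
  \<comment> \<open>Both matrices induce \<phi>, so their columns differ by elements of the column
    space, all of whose coordinates are multiples of the gcd.\<close>
  have "[det M = det U] (mod gcd_mat B)"
  proof (rule det_cong)
    fix i j
    have "cok_class B (M *v axis j 1) = cok_class B (U *v axis j 1)"
      using assms(3) U(2) unfolding induces_cok_def by metis
    then obtain z where z: "column j M - column j U = B *v z"
      unfolding cok_class_eq_iff colspace_def matrix_vector_axis by blast
    have "gcd_mat B dvd (column j M - column j U) $ i" unfolding z by (rule gcd_mat_dvd_mult)
    then show "[M $ i $ j = U $ i $ j] (mod gcd_mat B)" by (simp add: column_def cong_iff_dvd_diff)
  qed
  then show "[det M = 1] (mod gcd_mat B) \<or> [det M = -1] (mod gcd_mat B)"
    using det_invertible[OF U(1)] by auto
qed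

end
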